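(* Suppose that $g$ lies in $\mathcal{C}^2\cap\mathcal{D}^p\cap\mathcal{K}^{\max\{p,2\}}$ for some $p\in\mathbb{N}$ and let $a\ge 0$ and $x>0$ be such that $\Sigma g$ is convex on $[x+\lfloor a\rfloor,\infty)$. Then $$(a-\lceil a\rceil)\,g(x+\lceil a\rceil)\le(a-\lceil a\rceil)\,(\Sigma g)'(x+\lceil a\rceil)\le\Sigma g(x+a)-\Sigma g(x+\lceil a\rceil)\le(a-\lceil a\rceil)\,g(x+\lfloor a\rfloor).$$ (The inequalities are to be reversed if $\Sigma g$ is concave on $[x+\lfloor a\rfloor,\infty)$.)
   Context: $\mathbb{N}=\{0,1,2,\ldots\}$, $\mathbb{R}_+=(0,\infty)$, $\Delta f(x)=f(x+1)-f(x)$; $\mathcal{C}^r$ is the set of $r$ times continuously differentiable functions $\mathbb{R}_+\to\mathbb{R}$. For an integer $p\ge -1$, a function $f\colon I\to\mathbb{R}$ on a real interval $I$ is $p$-convex (resp. $p$-concave) if for all $x_0<\cdots<x_{p+1}$ in $I$ the divided difference $f[x_0,\ldots,x_{p+1}]$ is $\ge 0$ (resp. $\le 0$), where $f[x_0,\ldots,x_n]=\sum_{k=0}^n f(x_k)/\prod_{j\ne k}(x_k-x_j)$. $\mathcal{K}^p$ is the set of functions $\mathbb{R}_+\to\mathbb{R}$ that are $p$-convex on some $[a,\infty)$ or $p$-concave on some $[a,\infty)$ (and $\mathcal{K}^{p+1}\subset\mathcal{K}^p$). $\mathcal{D}^p$ is the set of $g\colon\mathbb{R}_+\to\mathbb{R}$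 with $\Delta^pg(n)\to 0$ as $n\to\infty$ over the integers. For $g\in\mathcal{D}^p\cap\mathcal{K}^p$, the function $\Sigma g\colon\mathbb{R}_+\to\mathbb{R}$ is $$\Sigma g(x)=\lim_{n\to\infty}\Big(-g(x)+\sum_{k=1}^{n-1}(g(k)-g(x+k))+\sum_{j=1}^p\binom{x}{j}\Delta^{j-1}g(n)\Big);$$ the limit exists, does not depend on the choice of such $p$, and $\Sigma g$ is the unique solution $f\in\mathcal{K}^p$ of $\Delta f=g$ with $f(1)=0$. Under the hypotheses, $\Sigma g\in\mathcal{C}^2$. *)

theory Defs
  imports "HOL-Analysis.Analysis"
begin

text \<open>
  Functions on the open half-line of positive reals are represented by total functions of type
  \<open>real \<Rightarrow> real\<close>; every notion below depends only on their values at positive arguments (values at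
  \<open>0\<close> enter sequences only through finitely many terms, hence never affect limits).
\<close>

definition fdiff :: "(real \<Rightarrow> real) \<Rightarrow> real \<Rightarrow> real" where
  "fdiff f = (\<lambda>x. f (x + 1) - f x)"

text \<open>On the open set \<open>{0<..}\<close>, the iterates of \<^const>\<open>deriv\<close> are the usual higher derivatives
  once the differentiability conditions hold.\<close>

definition C_class :: "nat \<Rightarrow> (real \<Rightarrow> real) set" where
  "C_class r = {f. (\<forall>k<r. (deriv ^^ k) f differentiable_on {0<..}) \<and>
                   continuous_on {0<..} ((deriv ^^ r) f)}"

definition divided_diff :: "(real \<Rightarrow> real) \<Rightarrow> nat \<Rightarrow> (nat \<Rightarrow> real) \<Rightarrow> real" where
  "divided_diff f n x = (\<Sum>k\<le>n. f (x k) / (\<Prod>j\<in>{..n} - {k}. x k - x j))"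

definition p_convex_on :: "nat \<Rightarrow> real set \<Rightarrow> (real \<Rightarrow> real) \<Rightarrow> bool" where
  "p_convex_on p I f \<longleftrightarrow>
     (\<forall>x. x ` {..p + 1} \<subseteq> I \<and> strict_mono_on {..p + 1} x \<longrightarrow> divided_diff f (p + 1) x \<ge> 0)"

definition p_concave_on :: "nat \<Rightarrow> real set \<Rightarrow> (real \<Rightarrow> real) \<Rightarrow> bool" where
  "p_concave_on p I f \<longleftrightarrow>
     (\<forall>x. x ` {..p + 1} \<subseteq> I \<and> strict_mono_on {..p + 1} x \<longrightarrow> divided_diff f (p + 1) x \<le> 0)"

definition K_class :: "nat \<Rightarrow> (real \<Rightarrow> real) set" where
  "K_class p = {f. \<exists>a>0. p_convex_on p {a..} f \<or> p_concave_on p {a..} f}"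

definition D_class :: "nat \<Rightarrow> (real \<Rightarrow> real) set" where
  "D_class p = {g. (\<lambda>n::nat. (fdiff ^^ p) g (real n)) \<longlonglongrightarrow> 0}"

text \<open>
  The principal indefinite sum of \<open>g\<close>. It is meaningful at \<open>x > 0\<close> and for
  \<open>g \<in> D_class p \<inter> K_class p\<close>; then the limit exists and is the same for all such \<open>p\<close>, so the
  parameter \<open>p\<close> only selects one of the equivalent defining formulas.
\<close>

definition Sigma_sum :: "nat \<Rightarrow> (real \<Rightarrow> real) \<Rightarrow> real \<Rightarrow> real" where
  "Sigma_sum p g x = lim (\<lambda>n::nat.
     - g x + (\<Sum>k = 1..<n. g (real k) - g (x + real k))
     + (\<Sum>j = 1..p. (x gchoose j) * (fdiff ^^ (j - 1)) g (real n)))"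

end

theory Submission
  imports Defs
begin

text \<open>
  Write \<open>S\<close> for \<open>\<Sigma>g\<close>. When \<open>a\<close> is an integer every term of the claim vanishes. Otherwise put
  \<open>c = x + \<lceil>a\<rceil>\<close> and \<open>t = \<lceil>a\<rceil> - a\<close>, so that \<open>x + \<lfloor>a\<rfloor> = c - 1\<close>. Since \<open>S (u + 1) = S u + g u\<close>, the
  values \<open>g (c - 1)\<close> and \<open>g c\<close> are the slopes of the chords of \<open>S\<close> over \<open>[c - 1, c]\<close> and
  \<open>[c, c + 1]\<close>. For convex \<open>S\<close> the claim is then the comparison of these two chords, the chord over
  \<open>[c - t, c]\<close> and the tangent at \<open>c\<close> (\<open>convex_chord_tangent_bounds\<close>); the concave case is the
  same applied to \<open>- S\<close>. What has to be supplied is the existence of the limit defining \<open>S\<close>, the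
  difference equation, and the differentiability of \<open>S\<close> at \<open>c\<close>.

  Existence of the limit: on \<open>(0, 1)\<close> the increments of the defining sequence are remainders of
  Newton interpolation of \<open>g\<close> at the nodes \<open>n, \<dots>, n + q\<close>, that is, a constant times a divided
  difference of order \<open>q + 1\<close>. By \<open>q\<close>-convexity or \<open>q\<close>-concavity these have constant sign and
  are bounded, up to a factor depending on \<open>x\<close> only, by the increments of \<open>\<Delta>\<^sup>q g(n) / q!\<close>, which telescope to a convergent series because \<open>\<Delta>\<^sup>q g(n)\<close> tends
  to zero (\<open>Sigma_approx_convergent_unit_interval\<close>). Convergence passes from \<open>x\<close> to \<open>x + 1\<close>, and
  this step also yields the difference equation (\<open>Sigma_approx_shift\<close>). With \<open>q = max p 2\<close>, the
  sequences for \<open>p\<close> and \<open>q\<close> differ by a null sequence.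

  Differentiability: divided differences of order \<open>q + 1\<close> of the approximants are sums of those
  of translates of \<open>g\<close>, up to sign, so \<open>S\<close> is \<open>q\<close>-concave or \<open>q\<close>-convex near infinity
  (\<open>Sigma_sum_one_signed_dd\<close>). A convex function with a kink at \<open>d\<close> violates both properties when
  \<open>q \<ge> 2\<close>: its divided differences over \<open>d - h, d, d + h\<close> blow up as \<open>h\<close> tends to zero, and further
  nodes on either side of \<open>d\<close> give the divided difference of order \<open>q + 1\<close> either sign
  (\<open>convex_one_signed_dd_differentiable\<close>). Hence \<open>S\<close> is differentiable at \<open>c + N\<close> for large \<open>N\<close>,
  and the difference equation transports this back to \<open>c\<close>.
\<close>

section \<open>Divided differences over finite sets of nodes\<close>

text \<open>
  Divided differences do not depend on the order of the nodes; indexing them by the set of nodes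
  lets nodes be split off or joined without renumbering.
\<close>

definition dd :: "(real \<Rightarrow> real) \<Rightarrow> real set \<Rightarrow> real" where
  "dd f X = (\<Sum>u\<in>X. f u / (\<Prod>v\<in>X - {u}. u - v))"

lemma dd_add: "dd (\<lambda>u. f u + h u) X = dd f X + dd h X"
  by (simp add: dd_def add_divide_distrib sum.distrib)

lemma dd_cmult: "dd (\<lambda>u. c * f u) X = c * dd f X"
  by (simp add: dd_def sum_distrib_left)

lemma dd_diff: "dd (\<lambda>u. f u - h u) X = dd f X - dd h X"
  by (simp add: dd_def diff_divide_distrib sum_subtractf)

lemma dd_sum: "dd (\<lambda>u. \<Sum>k\<in>K. f k u) X = (\<Sum>k\<in>K. dd (f k) X)"
  unfolding dd_def sum_divide_distrib by (rule sum.swap)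

lemma dd_shift: "dd (\<lambda>u. f (u + c)) X = dd f ((\<lambda>u. u + c) ` X)"
proof -
  have inj: "inj_on (\<lambda>u. u + c) Y" for Y :: "real set" by (simp add: inj_on_def)
  have "(\<Prod>v\<in>(\<lambda>u. u + c) ` X - {u + c}. u + c - v) = (\<Prod>v\<in>X - {u}. u - v)" for u
  proof -
    have "(\<lambda>u. u + c) ` X - {u + c} = (\<lambda>u. u + c) ` (X - {u})" by auto
    then show ?thesis by (simp add: prod.reindex[OF inj])
  qed
  then show ?thesis unfolding dd_def by (simp add: sum.reindex[OF inj])
qed

text \<open>
  A group of nodes can be absorbed into the function by dividing by its node polynomial. Nearly every
  identity for divided differences used below is a case of this splitting.
\<close>

lemma dd_union:
  assumes "finite X" "finite Y" "X \<inter> Y = {}"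
  shows "dd f (X \<union> Y) = dd (\<lambda>u. f u / (\<Prod>v\<in>Y. u - v)) X + dd (\<lambda>u. f u / (\<Prod>v\<in>X. u - v)) Y"
proof -
  have 1: "(\<Prod>v\<in>X \<union> Y - {u}. u - v) = (\<Prod>v\<in>Y. u - v) * (\<Prod>v\<in>X - {u}. u - v)" if "u \<in> X" for u
  proof -
    have "X \<union> Y - {u} = Y \<union> (X - {u})" using that assms by auto
    then show ?thesis using assms by (subst prod.union_disjoint[symmetric]) auto
  qed
  have 2: "(\<Prod>v\<in>X \<union> Y - {u}. u - v) = (\<Prod>v\<in>X. u - v) * (\<Prod>v\<in>Y - {u}. u - v)" if "u \<in> Y" for u
  proof -
    have "X \<union> Y - {u} = X \<union> (Y - {u})" using that assms by auto
    then show ?thesis using assms by (subst prod.union_disjoint[symmetric]) auto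
  qed
  show ?thesis
    unfolding dd_def using assms by (simp add: sum.union_disjoint 1 2)
qed

lemma dd_insert:
  assumes "finite Z" "a \<notin> Z"
  shows "dd f (insert a Z) = f a / (\<Prod>v\<in>Z. a - v) + dd (\<lambda>u. f u / (u - a)) Z"
  using dd_union[of "{a}" Z f] assms by (simp add: dd_def)

lemma dd_cong: "(\<And>u. u \<in> X \<Longrightarrow> f u = h u) \<Longrightarrow> dd f X = dd h X"
  by (simp add: dd_def)

lemma dd_recursion:
  assumes "finite Z" "a \<notin> Z" "b \<notin> Z" "a \<noteq> b"
  shows "(b - a) * dd f (insert a (insert b Z)) = dd f (insert b Z) - dd f (insert a Z)"
proof -
  define A B where "A = (\<Prod>v\<in>Z. a - v)" and "B = (\<Prod>v\<in>Z. b - v)"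
  have nz: "A \<noteq> 0" "B \<noteq> 0" using assms by (auto simp: A_def B_def)
  have "dd f (insert a (insert b Z)) =
      f a / ((a - b) * A) + (f b / ((b - a) * B) + dd (\<lambda>u. f u / (u - a) / (u - b)) Z)"
    using assms by (simp add: dd_insert A_def B_def)
  then have "(b - a) * dd f (insert a (insert b Z)) =
      - (f a / A) + f b / B + (b - a) * dd (\<lambda>u. f u / (u - a) / (u - b)) Z"
  proof -
    have "(b - a) * (f a / ((a - b) * A)) = - (f a / A)"
      using assms nz by (simp add: divide_simps) (simp add: algebra_simps)
    moreover have "(b - a) * (f b / ((b - a) * B)) = f b / B"
      using assms nz by (simp add: divide_simps)
    ultimately show ?thesis
      using \<open>dd f (insert a (insert b Z)) = _\<close> by (simp add: distrib_left)
  qed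
  also have "(b - a) * dd (\<lambda>u. f u / (u - a) / (u - b)) Z = dd (\<lambda>u. f u / (u - b) - f u / (u - a)) Z"
    unfolding dd_cmult[symmetric] using assms
    by (intro dd_cong) (auto simp: divide_simps, auto simp: algebra_simps)
  finally show ?thesis using assms by (simp add: dd_insert dd_diff A_def B_def)
qed

text \<open>
  The factor vanishes at the node \<open>a\<close> and cancels the contribution of \<open>a\<close> at every other node.
\<close>

lemma dd_linear_factor:
  assumes "finite Z" "a \<notin> Z"
  shows "dd (\<lambda>u. (u - a) * f u) (insert a Z) = dd f Z"
  using assms by (auto simp: dd_insert intro!: dd_cong)

text \<open>
  By the recursion, the divided difference over \<open>X\<close> is a multiple of the difference of two divided
  differences over sets with one node less; both are \<open>1\<close> if a single node is left, and both are
  zero otherwise by induction.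
\<close>

lemma dd_one:
  assumes "finite X" "card X \<ge> 2"
  shows "dd (\<lambda>_. 1) X = 0"
  using assms
proof (induction "card X" arbitrary: X rule: less_induct)
  case less
  from less.prems obtain a Y where X: "X = insert a Y" "a \<notin> Y" "card Y \<ge> 1"
    by (metis One_nat_def card_le_Suc_iff numeral_2_eq_2)
  then obtain b Z where Y: "Y = insert b Z" "b \<notin> Z"
    by (metis One_nat_def card.empty not_one_le_zero ex_in_conv mk_disjoint_insert)
  have fin: "finite Z" using less X Y by auto
  have ab: "a \<notin> Z" "a \<noteq> b" using X Y by auto
  have "dd (\<lambda>_. 1) (insert b Z) = dd (\<lambda>_. 1) (insert a Z)"
  proof (cases "Z = {}")
    case True then show ?thesis by (simp add: dd_def)
  next
    case False
    then have "card Z \<ge> 1" using fin by (simp add: Suc_leI card_gt_0_iff)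
    then have "dd (\<lambda>_. 1) (insert b Z) = 0" "dd (\<lambda>_. 1) (insert a Z) = 0"
      using less.hyps[of "insert b Z"] less.hyps[of "insert a Z"] X Y fin ab by auto
    then show ?thesis by simp
  qed
  then have "(b - a) * dd (\<lambda>_. 1) X = 0"
    using dd_recursion[OF fin ab(1) Y(2) ab(2)] X Y by simp
  then show ?case using ab by simp
qed

text \<open>
  The binomial coefficient is a polynomial of degree \<open>j\<close> and is therefore annihilated by divided
  differences of higher order. The induction step writes the linear factor of
  \<open>(j + 1) (u gchoose Suc j) = (u - j) (u gchoose j)\<close> as \<open>(u - a) + (a - j)\<close> for a node \<open>a\<close>.
\<close>

lemma dd_gchoose:
  assumes "finite X" "card X \<ge> j + 2"
  shows "dd (\<lambda>u. u gchoose j) X = 0"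
  using assms
proof (induction j arbitrary: X)
  case 0 then show ?case by (simp add: dd_one)
next
  case (Suc j)
  from Suc.prems have "X \<noteq> {}" by auto
  then obtain a Z where X: "X = insert a Z" "a \<notin> Z" by (metis ex_in_conv mk_disjoint_insert)
  have Z: "finite Z" "card Z \<ge> j + 2" using Suc.prems X by auto
  have "(u gchoose Suc j) = (1 / (real j + 1)) * ((u - a) * (u gchoose j) + (a - real j) * (u gchoose j))" for u :: real
    using gbinomial_mult_1[of u j] by (simp add: field_simps)
  then have "dd (\<lambda>u. u gchoose Suc j) X = (1 / (real j + 1)) *
      (dd (\<lambda>u. (u - a) * (u gchoose j)) X + (a - real j) * dd (\<lambda>u. u gchoose j) X)"
    by (simp only: dd_cmult dd_add)
  also have "\<dots> = 0"
    using Suc.IH[of Z] Suc.IH[of X] Suc.prems X Z by (simp add: dd_linear_factor)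
  finally show ?case .
qed

section \<open>Divided differences of constant sign\<close>

lemma divided_diff_eq_dd:
  assumes "inj_on x {..n}"
  shows "divided_diff f n x = dd f (x ` {..n})"
proof -
  have "(\<Prod>v\<in>x ` {..n} - {x k}. x k - v) = (\<Prod>j\<in>{..n} - {k}. x k - x j)" if "k \<le> n" for k
  proof -
    have "x ` {..n} - {x k} = x ` ({..n} - {k})"
      using assms that by (auto simp: inj_on_def)
    moreover have "inj_on x ({..n} - {k})" using assms by (auto intro: inj_on_subset)
    ultimately show ?thesis by (simp add: prod.reindex)
  qed
  then show ?thesis
    unfolding divided_diff_def dd_def by (simp add: sum.reindex[OF assms])
qed

text \<open>
  For \<open>\<sigma> = 1\<close> this is \<open>q\<close>-convexity and for \<open>\<sigma> = -1\<close> it is \<open>q\<close>-concavity on \<open>[A, \<infinity>)\<close>; the sign as a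
  parameter lets both be treated at once.
\<close>

definition one_signed_dd :: "nat \<Rightarrow> real \<Rightarrow> real \<Rightarrow> (real \<Rightarrow> real) \<Rightarrow> bool" where
  "one_signed_dd q A \<sigma> f \<longleftrightarrow>
     (\<forall>X. finite X \<and> X \<subseteq> {A..} \<and> card X = q + 2 \<longrightarrow> 0 \<le> \<sigma> * dd f X)"

lemma one_signed_ddD:
  assumes "one_signed_dd q A \<sigma> f" "finite X" "X \<subseteq> {A..}" "card X = q + 2"
  shows "0 \<le> \<sigma> * dd f X"
  using assms by (simp add: one_signed_dd_def)

lemma finite_set_increasing_enumeration:
  fixes X :: "real set"
  assumes "finite X" "card X = n + 1"
  obtains x where "strict_mono_on {..n} x" "X = x ` {..n}"
proof
  let ?l = "sorted_list_of_set X"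
  have len: "length ?l = n + 1" using assms by simp
  show "strict_mono_on {..n} (nth ?l)"
    using sorted_wrt_nth_less[OF strict_sorted_list_of_set[of X]] len
    by (auto simp: strict_mono_on_def)
  have "X = set ?l" using assms by simp
  also have "\<dots> = nth ?l ` {..n}"
    using len by (auto simp: set_conv_nth less_Suc_eq_le)
  finally show "X = nth ?l ` {..n}" .
qed

lemma K_class_one_signed_dd:
  assumes "g \<in> K_class q"
  obtains A \<sigma> where "A > 0" "\<sigma> = 1 \<or> \<sigma> = -1" "one_signed_dd q A \<sigma> g"
proof -
  from assms obtain A where A: "A > 0" "p_convex_on q {A..} g \<or> p_concave_on q {A..} g"
    by (auto simp: K_class_def)
  have enum: "\<exists>x. x ` {..q + 1} \<subseteq> {A..} \<and> strict_mono_on {..q + 1} x \<and> dd g X = divided_diff g (q + 1) x"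
    if X: "finite X" "X \<subseteq> {A..}" "card X = q + 2" for X
  proof -
    obtain x where x: "strict_mono_on {..q + 1} x" "X = x ` {..q + 1}"
      using finite_set_increasing_enumeration[of X "q + 1"] X by auto
    have "dd g X = divided_diff g (q + 1) x"
      using divided_diff_eq_dd[OF strict_mono_on_imp_inj_on[OF x(1)]] x(2) by simp
    then show ?thesis using X(2) x by (intro exI[of _ x]) simp
  qed
  show thesis
  proof (cases "p_convex_on q {A..} g")
    case True
    have "0 \<le> 1 * dd g X" if "finite X" "X \<subseteq> {A..}" "card X = q + 2" for X
      using enum[OF that] True unfolding p_convex_on_def by (metis mult_1)
    then show thesis using that[of A 1] A by (simp add: one_signed_dd_def)
  next
    case False
    then have concave: "p_concave_on q {A..} g" using A by simp
    have "0 \<le> (-1) * dd g X" if "finite X" "X \<subseteq> {A..}" "card X = q + 2" for X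
    proof -
      have "dd g X \<le> 0" using enum[OF that] concave unfolding p_concave_on_def by metis
      then show ?thesis by simp
    qed
    then show thesis using that[of A "-1"] A by (simp add: one_signed_dd_def)
  qed
qed

section \<open>Newton interpolation at equidistant nodes\<close>

definition grid :: "real \<Rightarrow> nat \<Rightarrow> real set" where
  "grid y m = (\<lambda>i. y + real i) ` {..m}"

lemma finite_grid [simp]: "finite (grid y m)"
  by (simp add: grid_def)

lemma grid_Suc: "grid y (Suc m) = insert (y + real (Suc m)) (grid y m)"
  by (simp add: grid_def atMost_Suc)

lemma last_notin_grid: "y + real (Suc m) \<notin> grid y m"
  by (auto simp: grid_def)

lemma grid_Suc_shift: "grid y (Suc m) = insert y (grid (y + 1) m)"
  unfolding grid_def atMost_Suc_eq_insert_0 by (simp add: image_image algebra_simps)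

lemma first_notin_grid: "y \<notin> grid (y + 1) m"
  by (auto simp: grid_def)

lemma dd_pair:
  assumes "a \<noteq> b"
  shows "dd f {a, b} = (f a - f b) / (a - b)"
proof -
  have "dd f {a, b} = f a / (a - b) + f b / (b - a)"
    using assms by (simp add: dd_insert) (simp add: dd_def)
  then show ?thesis by (metis add_uminus_conv_diff diff_divide_distrib minus_diff_eq minus_divide_right)
qed

lemma fdiff_iterate_eq_dd: "(fdiff ^^ k) f y = fact k * dd f (grid y k)"
proof (induction k arbitrary: y)
  case 0 then show ?case by (simp add: grid_def dd_def)
next
  case (Suc k)
  show ?case
  proof (cases k)
    case 0
    have "dd f (grid y 1) = f (y + 1) - f y"
      using dd_pair[of "y + 1" y f] by (simp add: grid_def atMost_Suc)
    then show ?thesis using 0 by (simp add: fdiff_def)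
  next
    case (Suc m)
    let ?Z = "grid (y + 1) m" and ?b = "y + 1 + real (Suc m)"
    have b: "?b \<notin> ?Z" by (rule last_notin_grid)
    have "(?b - y) * dd f (insert y (insert ?b ?Z)) = dd f (insert ?b ?Z) - dd f (insert y ?Z)"
      by (rule dd_recursion) (use first_notin_grid b in auto)
    moreover have "insert ?b ?Z = grid (y + 1) k" "insert y ?Z = grid y k"
        "insert y (insert ?b ?Z) = grid y (Suc k)"
      using Suc by (simp_all only: grid_Suc[of "y + 1"] grid_Suc_shift[of y])
    ultimately have "dd f (grid (y + 1) k) - dd f (grid y k) = real (Suc k) * dd f (grid y (Suc k))"
      using Suc by (simp add: algebra_simps)
    moreover have "(fdiff ^^ Suc k) f y = fact k * (dd f (grid (y + 1) k) - dd f (grid y k))"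
      by (simp add: fdiff_def Suc.IH right_diff_distrib)
    ultimately show ?thesis by simp
  qed
qed

text \<open>
  Newton's form of the interpolation error. Adding a node subtracts the next Newton term, and the
  recursion turns the difference of two divided differences into one of the next order.
\<close>

lemma Newton_remainder:
  assumes "x \<notin> real ` {..m}"
  shows "f (y + x) - (\<Sum>j\<le>m. (x gchoose j) * (fdiff ^^ j) f y) =
    (\<Prod>i\<le>m. x - real i) * dd f (insert (y + x) (grid y m))"
  using assms
proof (induction m)
  case 0
  then show ?case using dd_pair[of "y + x" y f] by (simp add: grid_def)
next
  case (Suc m)
  let ?Z = "grid y m" and ?a = "y + real (Suc m)" and ?P = "\<Prod>i\<le>m. x - real i"
  have x: "x \<notin> real ` {..m}" "x \<noteq> real (Suc m)"
    using Suc.prems by (auto simp: image_iff simp del: of_nat_Suc)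
  have b: "y + x \<notin> ?Z" using x by (auto simp: grid_def)
  have "(y + x - ?a) * dd f (insert ?a (insert (y + x) ?Z)) = dd f (insert (y + x) ?Z) - dd f (insert ?a ?Z)"
    by (rule dd_recursion) (use last_notin_grid b x in auto)
  then have rec: "(x - real (Suc m)) * dd f (insert (y + x) (grid y (Suc m))) =
      dd f (insert (y + x) ?Z) - dd f (grid y (Suc m))"
    by (simp only: grid_Suc insert_commute add_diff_cancel_left)
  have "(x gchoose Suc m) * (fdiff ^^ Suc m) f y = ?P * dd f (grid y (Suc m))"
    by (simp only: fdiff_iterate_eq_dd gbinomial_Suc) (simp add: atLeast0AtMost del: fact_Suc)
  then have "f (y + x) - (\<Sum>j\<le>Suc m. (x gchoose j) * (fdiff ^^ j) f y) =
      ?P * (dd f (insert (y + x) ?Z) - dd f (grid y (Suc m)))"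
    using Suc.IH[OF x(1)] by (simp only: sum.atMost_Suc right_diff_distrib diff_diff_eq[symmetric])
  also have "\<dots> = (\<Prod>i\<le>Suc m. x - real i) * dd f (insert (y + x) (grid y (Suc m)))"
    by (simp only: rec[symmetric] prod.atMost_Suc mult.assoc)
  finally show ?case .
qed

text \<open>
  The value over \<open>y, y + x, y + 1, \<dots>, y + m\<close> is, up to the factor \<open>x\<close>, the increase of the divided
  difference of order \<open>m\<close> when the node \<open>y\<close> moves to \<open>y + x\<close>. Divided differences of order \<open>m\<close> of an
  \<open>m\<close>-convex function increase with every node, so moving that node further, to \<open>y + m + 1\<close>, only
  increases the value, and the result is the grid shifted by one.
\<close>

lemma dd_between_grids_bounds:
  assumes sgn: "one_signed_dd m A \<sigma> f" and "A \<le> y" "0 < x" "x < 1"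
  shows "0 \<le> \<sigma> * dd f (insert (y + x) (grid y m))"
    and "x * (\<sigma> * dd f (insert (y + x) (grid y m))) \<le> \<sigma> * dd f (grid (y + 1) m) - \<sigma> * dd f (grid y m)"
proof -
  \<comment> \<open>The nodes shared by the two grids.\<close>
  define Z where "Z = (\<lambda>i. y + real i) ` {1..m}"
  let ?b = "y + x" and ?c = "y + real (Suc m)"
  have Z: "finite Z" "Z \<subseteq> {y..}" by (auto simp: Z_def)
  have first: "grid y m = insert y Z"
  proof -
    have "{..m} = insert 0 {1..m}" by auto
    then show ?thesis by (simp add: grid_def Z_def)
  qed
  have last: "grid (y + 1) m = insert ?c Z"
  proof -
    have "grid (y + 1) m = (\<lambda>i. y + real i) ` (Suc ` {..m})"
      by (simp add: grid_def image_image algebra_simps)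
    also have "Suc ` {..m} = insert (Suc m) {1..m}"
      unfolding image_Suc_atMost by auto
    finally show ?thesis by (simp add: Z_def)
  qed
  have notin: "y \<notin> Z" "?c \<notin> Z" by (auto simp: Z_def)
  have bZ: "?b \<notin> Z" using assms by (auto simp: Z_def)
  have bc: "?b \<noteq> ?c" using assms by simp
  have cardZ: "card Z = m" unfolding Z_def by (subst card_image) (auto simp: inj_on_def)
  show "0 \<le> \<sigma> * dd f (insert ?b (grid y m))"
    by (rule one_signed_ddD[OF sgn]) (use assms Z notin bZ cardZ in \<open>auto simp: first\<close>)
  have "0 \<le> \<sigma> * dd f (insert ?b (insert ?c Z))"
    by (rule one_signed_ddD[OF sgn]) (use assms Z notin bZ bc cardZ in auto)
  moreover have rec: "(?c - ?b) * dd f (insert ?b (insert ?c Z)) = dd f (insert ?c Z) - dd f (insert ?b Z)"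
    by (rule dd_recursion) (use Z notin bZ bc in auto)
  moreover have "0 \<le> ?c - ?b" using assms by simp
  ultimately have "0 \<le> \<sigma> * (dd f (insert ?c Z) - dd f (insert ?b Z))"
    by (metis mult.left_commute mult_nonneg_nonneg)
  moreover have "(?b - y) * dd f (insert y (insert ?b Z)) = dd f (insert ?b Z) - dd f (insert y Z)"
    by (rule dd_recursion) (use Z notin bZ assms in auto)
  then have "x * (\<sigma> * dd f (insert ?b (grid y m))) = \<sigma> * (dd f (insert ?b Z) - dd f (insert y Z))"
    by (simp add: first insert_commute[of y] mult.left_commute)
  ultimately show "x * (\<sigma> * dd f (insert ?b (grid y m))) \<le>
      \<sigma> * dd f (grid (y + 1) m) - \<sigma> * dd f (grid y m)"
    unfolding first last by (simp add: right_diff_distrib)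
qed

section \<open>The sequence defining the indefinite sum\<close>

definition Sigma_approx :: "nat \<Rightarrow> (real \<Rightarrow> real) \<Rightarrow> real \<Rightarrow> nat \<Rightarrow> real" where
  "Sigma_approx p g x n =
     - g x + (\<Sum>k = 1..<n. g (real k) - g (x + real k))
     + (\<Sum>j = 1..p. (x gchoose j) * (fdiff ^^ (j - 1)) g (real n))"

lemma Sigma_sum_eq_lim: "Sigma_sum p g x = lim (Sigma_approx p g x)"
  by (simp add: Sigma_sum_def Sigma_approx_def[abs_def])

lemma sum_binomial_shift:
  "(\<Sum>j = 1..p. c j * d (j - 1)) = (\<Sum>j<p. c (Suc j) * d j)" for c d :: "nat \<Rightarrow> real"
  by (rule sum.reindex_bij_witness[of _ Suc "\<lambda>j. j - 1"]) auto

lemma sum_atMost_first: "(\<Sum>j\<le>p. h j) = h 0 + (\<Sum>j = 1..p. h j)" for h :: "nat \<Rightarrow> real"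
proof -
  have "{..p} = insert 0 {1..p}" by auto
  then show ?thesis by simp
qed

lemma Sigma_approx_increment:
  assumes "n \<ge> 1"
  shows "Sigma_approx p g x (Suc n) - Sigma_approx p g x n =
    - (g (real n + x) - (\<Sum>j\<le>p. (x gchoose j) * (fdiff ^^ j) g (real n)))"
proof -
  have "(fdiff ^^ (j - 1)) g (real (Suc n)) - (fdiff ^^ (j - 1)) g (real n) = (fdiff ^^ j) g (real n)"
    if "j \<ge> 1" for j
    using that by (cases j) (simp_all add: fdiff_def add.commute)
  then have "(\<Sum>j = 1..p. (x gchoose j) * (fdiff ^^ (j - 1)) g (real (Suc n)))
      - (\<Sum>j = 1..p. (x gchoose j) * (fdiff ^^ (j - 1)) g (real n))
      = (\<Sum>j = 1..p. (x gchoose j) * (fdiff ^^ j) g (real n))"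
    by (simp only: sum_subtractf[symmetric] right_diff_distrib[symmetric]) simp
  then show ?thesis
    using assms by (simp add: Sigma_approx_def sum_atMost_first add.commute)
qed

lemma convergent_if_increments_summable:
  fixes s :: "nat \<Rightarrow> real"
  assumes "summable (\<lambda>n. s (Suc n) - s n)"
  shows "convergent s"
proof -
  have "convergent (\<lambda>n. (\<Sum>k<n. s (Suc k) - s k) + s 0)"
    using assms by (intro convergent_add convergent_const) (simp add: summable_iff_convergent)
  then show ?thesis by (simp add: sum_lessThan_telescope)
qed

text \<open>
  The increments are Newton remainders, which are dominated by the telescoping series of
  \<open>\<Delta>\<^sup>p g(n + 1) - \<Delta>\<^sup>p g(n)\<close>. The restriction to \<open>(0, 1)\<close> makes the extra node \<open>n + x\<close> lie
  between the first two grid nodes.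
\<close>

lemma Sigma_approx_convergent_unit_interval:
  assumes sgn: "one_signed_dd p A \<sigma> g" "\<sigma> = 1 \<or> \<sigma> = -1" and D: "g \<in> D_class p"
    and x: "0 < x" "x < 1"
  shows "convergent (Sigma_approx p g x)"
proof -
  define d where "d n = dd g (grid (real n) p)" for n
  define C where "C = \<bar>\<Prod>i\<le>p. x - real i\<bar> / x"
  have "(\<lambda>n. fact p * d n) \<longlonglongrightarrow> 0"
    using D by (simp add: D_class_def fdiff_iterate_eq_dd d_def)
  then have "(\<lambda>n. inverse (fact p) * (fact p * d n)) \<longlonglongrightarrow> inverse (fact p) * 0"
    by (rule tendsto_mult_left)
  then have "d \<longlonglongrightarrow> 0" by (simp add: mult.assoc[symmetric])
  then have summ: "summable (\<lambda>n. C * \<sigma> * (d (Suc n) - d n))"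
    by (intro summable_mult telescope_summable)
  have "summable (\<lambda>n. Sigma_approx p g x (Suc n) - Sigma_approx p g x n)"
  proof (rule summable_comparison_test'[OF summ])
    fix n assume n: "n \<ge> max 1 (nat \<lceil>A\<rceil>)"
    let ?E = "dd g (insert (real n + x) (grid (real n) p))"
    have A: "A \<le> real n" using n by linarith
    have notin: "x \<notin> real ` {..p}"
    proof
      assume "x \<in> real ` {..p}"
      then obtain i where "x = real i" by auto
      then show False using x by (cases i) auto
    qed
    have "Sigma_approx p g x (Suc n) - Sigma_approx p g x n = - ((\<Prod>i\<le>p. x - real i) * ?E)"
      using n by (simp only: Sigma_approx_increment max.bounded_iff Newton_remainder[OF notin])
    then have "\<bar>Sigma_approx p g x (Suc n) - Sigma_approx p g x n\<bar> = (C * x) * \<bar>?E\<bar>"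
      using x by (simp add: C_def abs_mult)
    also have "\<bar>?E\<bar> = \<sigma> * ?E"
      using dd_between_grids_bounds(1)[OF sgn(1) A x] sgn(2) by auto
    also have "C * x * (\<sigma> * ?E) \<le> C * (\<sigma> * d (Suc n) - \<sigma> * d n)"
      using dd_between_grids_bounds(2)[OF sgn(1) A x] x
      by (simp only: mult.assoc, intro mult_left_mono) (auto simp: d_def C_def add.commute)
    finally show "norm (Sigma_approx p g x (Suc n) - Sigma_approx p g x n) \<le> C * \<sigma> * (d (Suc n) - d n)"
      by (simp add: algebra_simps)
  qed
  then show ?thesis by (rule convergent_if_increments_summable)
qed

text \<open>
  By Pascal's rule, the sequences at \<open>x + 1\<close> and at \<open>x\<close> differ by \<open>g x\<close>, an increment of the sequence
  at \<open>x\<close>, and a multiple of \<open>\<Delta>\<^sup>p g(n)\<close>. The last two tend to zero.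
\<close>

lemma Sigma_approx_shift:
  assumes D: "g \<in> D_class p" and L: "Sigma_approx p g x \<longlonglongrightarrow> L"
  shows "Sigma_approx p g (x + 1) \<longlonglongrightarrow> L + g x"
proof -
  let ?S = "Sigma_approx p g x"
  have shift: "Sigma_approx p g (x + 1) n = ?S n + g x + (?S (Suc n) - ?S n)
      - (x gchoose p) * (fdiff ^^ p) g (real n)" if n: "n \<ge> 1" for n
  proof -
    have "(\<Sum>k = 1..<n. g (real k) - g (x + 1 + real k)) - (\<Sum>k = 1..<n. g (real k) - g (x + real k))
        = - (\<Sum>k = 1..<n. g (x + real (Suc k)) - g (x + real k))"
    proof -
      have shifted: "g (x + 1 + real k) = g (x + real (Suc k))" for k
        by (simp add: add.assoc)
      show ?thesis unfolding shifted sum_subtractf by linarith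
    qed
    also have "\<dots> = g (x + 1) - g (real n + x)"
      using n by (subst sum_Suc_diff'[of 1 n "\<lambda>k. g (x + real k)"]) (auto simp: add.commute)
    finally have sums: "(\<Sum>k = 1..<n. g (real k) - g (x + 1 + real k)) =
        (\<Sum>k = 1..<n. g (real k) - g (x + real k)) + g (x + 1) - g (real n + x)"
      by simp
    have binom: "(\<Sum>j = 1..p. (x + 1 gchoose j) * (fdiff ^^ (j - 1)) g (real n)) =
        (\<Sum>j = 1..p. (x gchoose j) * (fdiff ^^ (j - 1)) g (real n))
        + (\<Sum>j<p. (x gchoose j) * (fdiff ^^ j) g (real n))"
      using sum_binomial_shift[of "\<lambda>j. x gchoose j" "\<lambda>j. (fdiff ^^ j) g (real n)" p]
        sum_binomial_shift[of "\<lambda>j. x + 1 gchoose j" "\<lambda>j. (fdiff ^^ j) g (real n)" p]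
      by (simp add: gbinomial_Suc_Suc distrib_right sum.distrib)
    have "(\<Sum>j\<le>p. (x gchoose j) * (fdiff ^^ j) g (real n)) =
        (\<Sum>j<p. (x gchoose j) * (fdiff ^^ j) g (real n)) + (x gchoose p) * (fdiff ^^ p) g (real n)"
      by (simp add: lessThan_Suc_atMost[symmetric])
    then show ?thesis
      unfolding Sigma_approx_increment[OF n] unfolding Sigma_approx_def sums binom by simp
  qed
  have "(\<lambda>n. ?S n + g x + (?S (Suc n) - ?S n) - (x gchoose p) * (fdiff ^^ p) g (real n))
      \<longlonglongrightarrow> L + g x + (L - L) - (x gchoose p) * 0"
    using D by (intro tendsto_add tendsto_diff tendsto_const tendsto_mult_left LIMSEQ_Suc L)
      (simp add: D_class_def)
  then have "(\<lambda>n. ?S n + g x + (?S (Suc n) - ?S n) - (x gchoose p) * (fdiff ^^ p) g (real n))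
      \<longlonglongrightarrow> L + g x" by simp
  then show ?thesis
    by (rule Lim_transform_eventually)
      (use shift in \<open>auto intro!: eventually_sequentiallyI[of 1]\<close>)
qed

text \<open>
  Convergence on \<open>(0, 1)\<close> is known and at \<open>0\<close> the sequence is constant; the shift reaches all other
  arguments.
\<close>

lemma Sigma_approx_convergent:
  assumes sgn: "one_signed_dd p A \<sigma> g" "\<sigma> = 1 \<or> \<sigma> = -1" and D: "g \<in> D_class p"
    and x: "0 \<le> x"
  shows "convergent (Sigma_approx p g x)"
proof -
  have base: "convergent (Sigma_approx p g t)" if t: "0 \<le> t" "t < 1" for t
  proof (cases "t = 0")
    case True
    have "(0::real) gchoose j = 0" if "j \<ge> 1" for j using that by (cases j) auto
    then have "Sigma_approx p g 0 = (\<lambda>n. - g 0)" by (simp add: Sigma_approx_def fun_eq_iff)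
    then show ?thesis using True by (simp add: convergent_const)
  next
    case False
    then show ?thesis using Sigma_approx_convergent_unit_interval[OF sgn D] t by simp
  qed
  have "convergent (Sigma_approx p g (t + real m))" if t: "0 \<le> t" "t < 1" for t m
  proof (induction m)
    case 0 then show ?case using base t by simp
  next
    case (Suc m)
    then obtain L where "Sigma_approx p g (t + real m) \<longlonglongrightarrow> L" by (auto simp: convergent_def)
    from Sigma_approx_shift[OF D this] show ?case by (auto simp: convergent_def algebra_simps)
  qed
  from this[OF frac_ge_0[of x] frac_lt_1[of x], of "nat \<lfloor>x\<rfloor>"] show ?thesis
    using x by (simp add: frac_def)
qed

lemma higher_fdiff_tendsto_0:
  assumes "g \<in> D_class p" "p \<le> j"
  shows "(\<lambda>n. (fdiff ^^ j) g (real n)) \<longlonglongrightarrow> 0"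
  using assms(2)
proof (induction j rule: dec_induct)
  case base then show ?case using assms(1) by (simp add: D_class_def)
next
  case (step j)
  have "(\<lambda>n. (fdiff ^^ j) g (real (Suc n)) - (fdiff ^^ j) g (real n)) \<longlonglongrightarrow> 0 - 0"
    using step.IH by (intro tendsto_diff LIMSEQ_Suc)
  moreover have "(fdiff ^^ Suc j) g (real n) = (fdiff ^^ j) g (real (Suc n)) - (fdiff ^^ j) g (real n)" for n
    by (simp add: fdiff_def[of "(fdiff ^^ j) g"] add.commute)
  ultimately show ?case by simp
qed

text \<open>
  The convexity order \<open>q\<close> may exceed \<open>p\<close>: the sequence for \<open>q\<close> converges, and it differs from the one
  for \<open>p\<close> only by terms containing \<open>\<Delta>\<^sup>j g(n)\<close> with \<open>j \<ge> p\<close>, which tend to zero.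
\<close>

lemma Sigma_approx_tendsto_Sigma_sum:
  assumes "g \<in> D_class p" "g \<in> K_class q" "p \<le> q" "0 \<le> x"
  shows "Sigma_approx p g x \<longlonglongrightarrow> Sigma_sum p g x"
proof -
  obtain A \<sigma> where sgn: "one_signed_dd q A \<sigma> g" "\<sigma> = 1 \<or> \<sigma> = -1"
    using K_class_one_signed_dd[OF assms(2)] by metis
  have "g \<in> D_class q" using higher_fdiff_tendsto_0[OF assms(1,3)] by (simp add: D_class_def)
  then obtain L where L: "Sigma_approx q g x \<longlonglongrightarrow> L"
    using Sigma_approx_convergent[OF sgn] assms(4) by (auto simp: convergent_def)
  have split: "{1..q} = {1..p} \<union> {p+1..q}" using assms(3) by auto
  have diff: "Sigma_approx p g x n =
      Sigma_approx q g x n - (\<Sum>j = p+1..q. (x gchoose j) * (fdiff ^^ (j - 1)) g (real n))" for n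
    unfolding Sigma_approx_def split by (subst sum.union_disjoint) auto
  have "(\<lambda>n. \<Sum>j = p+1..q. (x gchoose j) * (fdiff ^^ (j - 1)) g (real n))
      \<longlonglongrightarrow> (\<Sum>j = p+1..q. (x gchoose j) * 0)"
    by (intro tendsto_sum tendsto_mult_left higher_fdiff_tendsto_0[OF assms(1)]) auto
  then have "Sigma_approx p g x \<longlonglongrightarrow> L - 0"
    unfolding diff[abs_def] using L by (intro tendsto_diff) auto
  then have "Sigma_approx p g x \<longlonglongrightarrow> L" by simp
  then show ?thesis unfolding Sigma_sum_eq_lim by (simp add: limI)
qed

lemma Sigma_sum_shift:
  assumes "g \<in> D_class p" "g \<in> K_class q" "p \<le> q" "0 \<le> x"
  shows "Sigma_sum p g (x + 1) = Sigma_sum p g x + g x"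
proof (rule LIMSEQ_unique)
  show "Sigma_approx p g (x + 1) \<longlonglongrightarrow> Sigma_sum p g (x + 1)"
    using assms by (intro Sigma_approx_tendsto_Sigma_sum) auto
  show "Sigma_approx p g (x + 1) \<longlonglongrightarrow> Sigma_sum p g x + g x"
    using assms by (intro Sigma_approx_shift Sigma_approx_tendsto_Sigma_sum) auto
qed

lemma dd_Sigma_approx:
  assumes "finite X" "card X = q + 2" "p \<le> q"
  shows "dd (\<lambda>u. Sigma_approx p g u n) X = - dd g X - (\<Sum>k = 1..<n. dd g ((\<lambda>u. u + real k) ` X))"
proof -
  define c where "c = (\<Sum>k = 1..<n. g (real k))"
  have "Sigma_approx p g u n = (-1) * g u + (c * 1 - (\<Sum>k = 1..<n. g (u + real k)))
      + (\<Sum>j = 1..p. (fdiff ^^ (j - 1)) g (real n) * (u gchoose j))" for u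
    by (simp add: Sigma_approx_def c_def sum_subtractf mult.commute)
  then have "dd (\<lambda>u. Sigma_approx p g u n) X =
      (-1) * dd g X + (c * dd (\<lambda>_. 1) X - (\<Sum>k = 1..<n. dd (\<lambda>u. g (u + real k)) X))
      + (\<Sum>j = 1..p. (fdiff ^^ (j - 1)) g (real n) * dd (\<lambda>u. u gchoose j) X)"
    by (simp only: dd_add dd_diff dd_sum dd_cmult)
  then show ?thesis using assms by (simp add: dd_one dd_gchoose dd_shift)
qed

text \<open>
  The sign is passed on by every approximant, whose binomial part is annihilated, and survives the
  pointwise limit. It is opposite to the sign belonging to \<open>g\<close>, since translates of \<open>g\<close> are subtracted.
\<close>

lemma Sigma_sum_one_signed_dd:
  assumes D: "g \<in> D_class p" and K: "g \<in> K_class q" and "p \<le> q"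
  obtains A \<sigma> where "\<sigma> = 1 \<or> \<sigma> = -1" "one_signed_dd q A \<sigma> (Sigma_sum p g)"
proof -
  obtain A \<sigma> where A: "A > 0" "\<sigma> = 1 \<or> \<sigma> = -1" and sgn: "one_signed_dd q A \<sigma> g"
    using K_class_one_signed_dd[OF K] by metis
  have "0 \<le> - \<sigma> * dd (Sigma_sum p g) X" if X: "finite X" "X \<subseteq> {A..}" "card X = q + 2" for X
  proof (rule LIMSEQ_le_const)
    have "0 \<le> u" if "u \<in> X" for u using that X A by force
    then show "(\<lambda>n. - \<sigma> * dd (\<lambda>u. Sigma_approx p g u n) X) \<longlonglongrightarrow> - \<sigma> * dd (Sigma_sum p g) X"
      unfolding dd_def divide_inverse using assms
      by (intro tendsto_mult_left tendsto_sum tendsto_mult_right Sigma_approx_tendsto_Sigma_sum) auto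
    have "0 \<le> \<sigma> * dd g ((\<lambda>u. u + real k) ` X)" for k
    proof (rule one_signed_ddD[OF sgn])
      show "card ((\<lambda>u. u + real k) ` X) = q + 2"
        using X by (simp add: card_image inj_on_def)
    qed (use X in force)+
    moreover have "0 \<le> \<sigma> * dd g X" using X by (intro one_signed_ddD[OF sgn])
    ultimately have "0 \<le> \<sigma> * dd g X + (\<Sum>k = 1..<n. \<sigma> * dd g ((\<lambda>u. u + real k) ` X))" for n
      by (intro add_nonneg_nonneg sum_nonneg)
    then have "0 \<le> - \<sigma> * dd (\<lambda>u. Sigma_approx p g u n) X" for n
      unfolding dd_Sigma_approx[OF X(1,3) \<open>p \<le> q\<close>]
      by (simp only: sum_distrib_left[symmetric]) (simp add: right_diff_distrib)
    then show "\<exists>N. \<forall>n\<ge>N. 0 \<le> - \<sigma> * dd (\<lambda>u. Sigma_approx p g u n) X" by blast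
  qed
  then show thesis using that[of "- \<sigma>" A] A by (auto simp: one_signed_dd_def)
qed

section \<open>Differentiability of convex functions with one-signed divided differences\<close>

text \<open>
  If \<open>m\<close> is a subgradient, both one-sided difference quotients lie on their own side of \<open>m\<close>, so
  that their distances to \<open>m\<close> add up to the symmetric second difference quotient.
\<close>

lemma DERIV_if_symmetric_difference_vanishes:
  fixes f :: "real \<Rightarrow> real"
  assumes "r > 0" and below: "\<And>y. \<bar>y - d\<bar> < r \<Longrightarrow> f d + m * (y - d) \<le> f y"
    and lim: "((\<lambda>h. (f (d + h) - 2 * f d + f (d - h)) / \<bar>h\<bar>) \<longlongrightarrow> 0) (at 0)"
  shows "(f has_real_derivative m) (at d)"
proof -
  have bound: "\<bar>(f (d + h) - f d) / h - m\<bar> \<le> (f (d + h) - 2 * f d + f (d - h)) / \<bar>h\<bar>"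
    if h: "h \<noteq> 0" "\<bar>h\<bar> < r" for h
  proof -
    have "0 \<le> f (d + h) - f d - m * h" using below[of "d + h"] h by simp
    moreover have "0 \<le> f (d - h) - f d + m * h" using below[of "d - h"] h by simp
    moreover have "(f (d + h) - f d) / h - m = (f (d + h) - f d - m * h) / h"
      using h by (simp add: field_simps)
    ultimately show ?thesis by (auto simp: abs_divide intro!: divide_right_mono)
  qed
  have "((\<lambda>h. (f (d + h) - f d) / h - m) \<longlongrightarrow> 0) (at 0)"
  proof (rule Lim_null_comparison[OF _ lim])
    show "\<forall>\<^sub>F h in at 0. norm ((f (d + h) - f d) / h - m) \<le> (f (d + h) - 2 * f d + f (d - h)) / \<bar>h\<bar>"
      using bound \<open>r > 0\<close> by (auto simp: eventually_at dist_real_def)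
  qed
  then show ?thesis unfolding DERIV_def by (rule LIM_zero_cancel)
qed

lemma reciprocal_node_product_differentiable:
  fixes d :: real
  assumes "finite Y" "d \<notin> Y"
  shows "\<exists>w'. ((\<lambda>u. 1 / (\<Prod>v\<in>Y. u - v)) has_real_derivative w') (at d)"
  using assms
proof (induction Y rule: finite_induct)
  case empty then show ?case by (auto intro: DERIV_const)
next
  case (insert y Y)
  then obtain w' where w': "((\<lambda>u. 1 / (\<Prod>v\<in>Y. u - v)) has_real_derivative w') (at d)" by auto
  have "((\<lambda>u. 1 / (u - y)) has_real_derivative - 1 / (d - y)\<^sup>2) (at d)"
    using insert.prems by (auto intro!: derivative_eq_intros simp: power2_eq_square)
  from DERIV_mult[OF this w'] insert show ?case by auto
qed

lemma dd_symmetric_triple: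
  assumes "h \<noteq> 0"
  shows "dd F {d - h, d, d + h} = (F (d + h) - 2 * F d + F (d - h)) / (2 * h\<^sup>2)"
proof -
  have "dd F {d - h, d, d + h} = dd F (insert d {d - h, d + h})" by (simp add: insert_commute)
  also have "\<dots> = F d / (h * (- h)) + (F (d - h) / (- h) - F (d + h) / h) / (- 2 * h)"
    using assms by (simp add: dd_insert[of "{d - h, d + h}" d] dd_pair)
  also have "\<dots> = (F (d + h) - 2 * F d + F (d - h)) / (2 * h\<^sup>2)"
    using assms by (simp add: divide_simps power2_eq_square)
  finally show ?thesis .
qed

text \<open>
  The sign of \<open>\<Prod>v\<in>Y. d - v\<close> is given by the parity of the number of nodes to the right of \<open>d\<close>.
  Since \<open>q \<ge> 2\<close>, there is a node, and it can be placed on either side. Nodes at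
  distance at least \<open>1\<close> from \<open>d\<close> stay apart, for small \<open>h\<close>, from \<open>d - h\<close> and \<open>d + h\<close>.
\<close>

lemma auxiliary_nodes_with_sign:
  fixes d :: real
  assumes "q \<ge> 2" "\<sigma> = 1 \<or> \<sigma> = -1" "A + real q \<le> d"
  obtains Y where "finite Y" "card Y = q - 1" "Y \<subseteq> {A..}" "\<And>v. v \<in> Y \<Longrightarrow> \<bar>d - v\<bar> \<ge> 1"
    "\<sigma> * (1 / (\<Prod>v\<in>Y. d - v)) < 0"
proof -
  define L where "L m = (\<lambda>i. d - real i) ` {1..m}" for m
  have inj: "inj_on (\<lambda>i. d - real i) {1..m}" for m by (simp add: inj_on_def)
  have L: "finite (L m)" "card (L m) = m" "d + 1 \<notin> L m" for m
    unfolding L_def by (auto simp: card_image[OF inj, simplified])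
  have pos: "0 < (\<Prod>v\<in>L m. d - v)" for m
    by (rule prod_pos) (auto simp: L_def)
  have far: "\<bar>d - v\<bar> \<ge> 1" if "v \<in> L m" for v m using that by (auto simp: L_def)
  have sub: "L m \<subseteq> {A..}" if "m \<le> q" for m using that assms(3) by (auto simp: L_def)
  from assms(2) show thesis
  proof
    assume \<sigma>: "\<sigma> = 1"
    have "\<bar>d - v\<bar> \<ge> 1" if "v \<in> insert (d + 1) (L (q - 2))" for v
      using that far[of v "q - 2"] by auto
    moreover have "card (insert (d + 1) (L (q - 2))) = q - 1" using L assms(1) by simp
    ultimately show thesis
      using that[of "insert (d + 1) (L (q - 2))"] L pos[of "q - 2"] sub[of "q - 2"] assms \<sigma>
      by (auto simp: divide_simps)
  next
    assume "\<sigma> = -1"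
    then show thesis
      using that[of "L (q - 1)"] L pos[of "q - 1"] far sub[of "q - 1"] assms by auto
  qed
qed

text \<open>
  Over the nodes \<open>d - h, d, d + h\<close> and the auxiliary set \<open>Y\<close>, the divided difference multiplied by
  \<open>2 \<bar>h\<bar>\<close> is \<open>w d\<close> times the symmetric second difference quotient of \<open>f\<close>, up to terms that tend to
  zero; here \<open>w\<close> is the reciprocal of the node polynomial of \<open>Y\<close>. With \<open>Y\<close> chosen such that
  \<open>\<sigma> * w d < 0\<close>, the sign condition bounds the nonnegative quotient from above by these terms.
\<close>

lemma one_signed_dd_symmetric_difference_vanishes:
  assumes sgn: "one_signed_dd q A \<sigma> f" "\<sigma> = 1 \<or> \<sigma> = -1" and q: "q \<ge> 2" and dA: "A + real q \<le> d"
    and cont: "isCont f d" and nonneg: "\<And>h. \<bar>h\<bar> < 1 \<Longrightarrow> 0 \<le> f (d + h) - 2 * f d + f (d - h)"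
  shows "((\<lambda>h. (f (d + h) - 2 * f d + f (d - h)) / \<bar>h\<bar>) \<longlongrightarrow> 0) (at 0)"
proof -
  obtain Y where Y: "finite Y" "card Y = q - 1" "Y \<subseteq> {A..}" "\<And>v. v \<in> Y \<Longrightarrow> \<bar>d - v\<bar> \<ge> 1"
    and neg: "\<sigma> * (1 / (\<Prod>v\<in>Y. d - v)) < 0"
    using auxiliary_nodes_with_sign[OF q sgn(2) dA] by metis
  have dY: "d \<notin> Y" using Y(4) by force
  define w where "w u = 1 / (\<Prod>v\<in>Y. u - v)" for u
  define \<kappa> where "\<kappa> = - (\<sigma> * w d)"
  have \<kappa>: "\<kappa> > 0" using neg by (simp add: \<kappa>_def w_def)
  define \<psi> where "\<psi> h = (f (d + h) - 2 * f d + f (d - h)) / \<bar>h\<bar>" for h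
  \<comment> \<open>\<open>B\<close> collects the variation of \<open>w\<close> near \<open>d\<close>, and \<open>T\<close> the contribution of the nodes in \<open>Y\<close>.\<close>
  define B where "B h = f (d + h) * ((w (d + h) - w d) / h) + f (d - h) * ((w (d - h) - w d) / h)" for h
  define T where "T h = dd (\<lambda>u. f u / ((u - (d - h)) * (u - d) * (u - (d + h)))) Y" for h
  have main: "\<kappa> * \<psi> h \<le> \<bar>B h\<bar> + \<bar>2 * \<bar>h\<bar> * T h\<bar>" if h: "h \<noteq> 0" "\<bar>h\<bar> < 1" for h
  proof -
    let ?X = "{d - h, d, d + h}"
    have disj: "?X \<inter> Y = {}" using Y(4)[of "d - h"] Y(4)[of "d + h"] dY h by auto
    have cX: "card ?X = 3" using h by simp
    have "0 \<le> \<sigma> * dd f (?X \<union> Y)"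
    proof (rule one_signed_ddD[OF sgn(1)])
      show "card (?X \<union> Y) = q + 2" using disj Y cX q by (subst card_Un_disjoint) auto
      show "?X \<union> Y \<subseteq> {A..}" using Y(3) dA q h by auto
    qed (use Y in auto)
    also have "dd f (?X \<union> Y) = dd (\<lambda>u. f u * w u) ?X + T h"
    proof -
      have "(\<Prod>v\<in>?X. u - v) = (u - (d - h)) * (u - d) * (u - (d + h))" for u
        using h by simp
      moreover have "finite ?X" by simp
      ultimately show ?thesis
        using dd_union[OF _ Y(1) disj, of f] by (simp add: T_def w_def)
    qed
    also have "dd (\<lambda>u. f u * w u) ?X =
        (f (d + h) * w (d + h) - 2 * (f d * w d) + f (d - h) * w (d - h)) / (2 * h\<^sup>2)"
      by (rule dd_symmetric_triple[OF h(1)])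
    also have "f (d + h) * w (d + h) - 2 * (f d * w d) + f (d - h) * w (d - h) =
        w d * (\<bar>h\<bar> * \<psi> h) + h * B h"
    proof -
      have "\<bar>h\<bar> * \<psi> h = f (d + h) - 2 * f d + f (d - h)" using h by (simp add: \<psi>_def)
      moreover have "h * B h = f (d + h) * (w (d + h) - w d) + f (d - h) * (w (d - h) - w d)"
        using h by (simp add: B_def distrib_left)
      ultimately show ?thesis by (simp only:) (simp add: algebra_simps)
    qed
    finally have "0 \<le> (2 * \<bar>h\<bar>) * (\<sigma> * ((w d * (\<bar>h\<bar> * \<psi> h) + h * B h) / (2 * h\<^sup>2) + T h))"
      by simp
    also have "\<dots> = - \<kappa> * \<psi> h + \<sigma> * (sgn h * B h) + \<sigma> * (2 * \<bar>h\<bar> * T h)"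
    proof -
      have "(2 * \<bar>h\<bar>) * ((w d * (\<bar>h\<bar> * \<psi> h) + h * B h) / (2 * h\<^sup>2)) = w d * \<psi> h + sgn h * B h"
        using h by (cases "h > 0") (simp_all add: field_simps power2_eq_square)
      then have "(2 * \<bar>h\<bar>) * ((w d * (\<bar>h\<bar> * \<psi> h) + h * B h) / (2 * h\<^sup>2) + T h) =
          w d * \<psi> h + sgn h * B h + 2 * \<bar>h\<bar> * T h" by (simp only: distrib_left)
      then show ?thesis
        by (simp only: mult.left_commute[of _ \<sigma>]) (simp add: \<kappa>_def algebra_simps)
    qed
    also have "\<dots> \<le> - \<kappa> * \<psi> h + \<bar>B h\<bar> + \<bar>2 * \<bar>h\<bar> * T h\<bar>"
    proof -
      have "\<bar>\<sigma> * (sgn h * B h)\<bar> = \<bar>B h\<bar>" "\<bar>\<sigma> * (2 * \<bar>h\<bar> * T h)\<bar> = \<bar>2 * \<bar>h\<bar> * T h\<bar>"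
        using sgn(2) h by (auto simp: abs_mult abs_sgn_eq)
      then show ?thesis by linarith
    qed
    finally show ?thesis by simp
  qed
  have "(B \<longlongrightarrow> 0) (at 0)"
  proof -
    obtain w' where w': "(w has_real_derivative w') (at d)"
      using reciprocal_node_product_differentiable[OF Y(1) dY] by (auto simp: w_def[abs_def])
    have 1: "((\<lambda>h. (w (d + h) - w d) / h) \<longlongrightarrow> w') (at 0)" using w' by (simp add: DERIV_def)
    have "((\<lambda>h. w (d - h)) has_real_derivative w' * (0 - 1)) (at 0)"
      by (rule DERIV_chain2[where g = "\<lambda>h. d - h"]) (use w' in \<open>auto intro!: derivative_eq_intros\<close>)
    then have 2: "((\<lambda>h. (w (d - h) - w d) / h) \<longlongrightarrow> - w') (at 0)" by (simp add: DERIV_def)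
    have 3: "((\<lambda>h. f (d + h)) \<longlongrightarrow> f d) (at 0)" using cont by (simp add: isCont_iff)
    have "((\<lambda>h. d - h) \<longlongrightarrow> d - 0) (at 0)" by (intro tendsto_intros)
    then have 4: "((\<lambda>h. f (d - h)) \<longlongrightarrow> f d) (at 0)"
      by (intro isCont_tendsto_compose[OF cont]) simp
    \<comment> \<open>The first-order variations of \<open>w\<close> on the two sides of \<open>d\<close> cancel.\<close>
    have "(B \<longlongrightarrow> f d * w' + f d * (- w')) (at 0)"
      unfolding B_def[abs_def] by (intro tendsto_add tendsto_mult 1 2 3 4)
    then show ?thesis by simp
  qed
  moreover have "((\<lambda>h. 2 * \<bar>h\<bar> * T h) \<longlongrightarrow> 2 * \<bar>0\<bar> * T 0) (at 0)"
    unfolding T_def dd_def using dY Y(1)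
    by (intro tendsto_intros) auto
  then have "((\<lambda>h. 2 * \<bar>h\<bar> * T h) \<longlongrightarrow> 0) (at 0)" by simp
  ultimately have "((\<lambda>h. (\<bar>B h\<bar> + \<bar>2 * \<bar>h\<bar> * T h\<bar>) / \<kappa>) \<longlongrightarrow> (\<bar>0\<bar> + \<bar>0\<bar>) / \<kappa>) (at 0)"
    using \<kappa> by (intro tendsto_divide tendsto_add tendsto_rabs tendsto_const) auto
  then have lim: "((\<lambda>h. (\<bar>B h\<bar> + \<bar>2 * \<bar>h\<bar> * T h\<bar>) / \<kappa>) \<longlongrightarrow> 0) (at 0)" by simp
  have "(\<psi> \<longlongrightarrow> 0) (at 0)"
  proof (rule Lim_null_comparison[OF _ lim])
    have "norm (\<psi> h) \<le> (\<bar>B h\<bar> + \<bar>2 * \<bar>h\<bar> * T h\<bar>) / \<kappa>" if h: "h \<noteq> 0" "\<bar>h\<bar> < 1" for h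
    proof -
      have "0 \<le> \<psi> h" using nonneg[OF h(2)] by (simp add: \<psi>_def)
      then show ?thesis using main[OF h] \<kappa> by (simp add: pos_le_divide_eq mult.commute)
    qed
    then show "\<forall>\<^sub>F h in at 0. norm (\<psi> h) \<le> (\<bar>B h\<bar> + \<bar>2 * \<bar>h\<bar> * T h\<bar>) / \<kappa>"
      by (auto simp: eventually_at dist_real_def intro!: exI[of _ 1])
  qed
  then show ?thesis by (simp add: \<psi>_def[abs_def])
qed

text \<open>
  A convex function has a subgradient at every interior point, and the previous lemma excludes a
  kink.
\<close>

lemma convex_one_signed_dd_differentiable:
  assumes sgn: "one_signed_dd q A \<sigma> f" "\<sigma> = 1 \<or> \<sigma> = -1" and q: "q \<ge> 2" and dA: "A + real q \<le> d"
    and conv: "convex_on {c..} f" and cd: "c + 1 \<le> d"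
  shows "\<exists>D. (f has_real_derivative D) (at d)"
proof -
  have "convex_on {c<..} f" by (rule convex_on_subset[OF conv]) auto
  then have "continuous_on {c<..} f" by (intro convex_on_continuous) auto
  then have cont: "isCont f d" using cd by (auto simp: continuous_on_eq_continuous_at)
  have int: "d \<in> interior {c..}" using cd by simp
  define m where "m = Inf ((\<lambda>t. (f d - f t) / (d - t)) ` ({d<..} \<inter> {c..}))"
  have below: "f d + m * (y - d) \<le> f y" if "\<bar>y - d\<bar> < 1" for y
    unfolding m_def using that cd by (intro convex_le_Inf_differential[OF conv int]) auto
  have "0 \<le> f (d + h) - 2 * f d + f (d - h)" if "\<bar>h\<bar> < 1" for h
    using below[of "d + h"] below[of "d - h"] that by simp
  then show ?thesis
    using DERIV_if_symmetric_difference_vanishes[of 1 d f m] below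
      one_signed_dd_symmetric_difference_vanishes[OF sgn q dA cont] by auto
qed

text \<open>
  Solving the difference equation for \<open>S u\<close> expresses \<open>S\<close> near \<open>y\<close> through its values near \<open>y + 1\<close>.
\<close>

lemma differentiable_backwards_along_shift:
  assumes shift: "\<And>u. 0 < u \<Longrightarrow> S (u + 1) = S u + g u"
    and g: "\<And>u. 0 < u \<Longrightarrow> \<exists>D. (g has_real_derivative D) (at u)"
    and y: "0 < y" and D: "\<exists>D. (S has_real_derivative D) (at (y + real n))"
  shows "\<exists>D. (S has_real_derivative D) (at (y::real))"
  using D
proof (induction n)
  case 0 then show ?case by simp
next
  case (Suc n)
  let ?z = "y + real n"
  have z: "?z > 0" using y by simp
  from Suc.prems obtain D where D: "(S has_real_derivative D) (at (?z + 1))" by (auto simp: algebra_simps)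
  obtain E where E: "(g has_real_derivative E) (at ?z)" using g[OF z] by blast
  have "((\<lambda>u. S (u + 1) - g u) has_real_derivative D - E) (at ?z)"
    using D E by (intro DERIV_diff) (simp_all add: DERIV_shift)
  then have "(S has_real_derivative D - E) (at ?z)"
    by (rule has_field_derivative_transform_within_open[of _ _ _ "{0<..}"]) (use z shift in auto)
  then show ?case using Suc.IH by blast
qed

section \<open>Chords and tangents of the indefinite sum\<close>

lemma convex_chord_tangent_bounds:
  fixes f :: "real \<Rightarrow> real"
  assumes conv: "convex_on {c - 1..} f" and D: "(f has_real_derivative D) (at c)"
    and t: "0 \<le> t" "t \<le> 1"
  shows "- t * (f (c + 1) - f c) \<le> - t * D" "- t * D \<le> f (c - t) - f c"
    "f (c - t) - f c \<le> - t * (f c - f (c - 1))"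
proof -
  have tangent: "f c + D * (y - c) \<le> f y" if "y \<ge> c - 1" for y
  proof -
    have "(f has_real_derivative D) (at c within {c - 1..})"
      using D by (rule has_field_derivative_at_within)
    then have "D * (y - c) \<le> f y - f c"
      by (intro convex_on_imp_above_tangent[OF conv]) (use that in auto)
    then show ?thesis by simp
  qed
  show "- t * (f (c + 1) - f c) \<le> - t * D"
    using tangent[of "c + 1"] t by (simp add: mult_left_mono)
  show "- t * D \<le> f (c - t) - f c" using tangent[of "c - t"] t by (simp add: algebra_simps)
  have "f ((1 - t) *\<^sub>R c + t *\<^sub>R (c - 1)) \<le> (1 - t) * f c + t * f (c - 1)"
    by (rule convex_onD[OF conv]) (use t in auto)
  moreover have "(1 - t) *\<^sub>R c + t *\<^sub>R (c - 1) = c - t" by (simp add: algebra_simps)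
  ultimately show "f (c - t) - f c \<le> - t * (f c - f (c - 1))"
    by (simp add: algebra_simps)
qed

theorem proposition8p67:
  fixes g :: "real \<Rightarrow> real" and p :: nat and a x :: real
  assumes "g \<in> C_class 2 \<inter> D_class p \<inter> K_class (max p 2)"
    and "a \<ge> 0" and "x > 0"
  shows "(convex_on {x + of_int \<lfloor>a\<rfloor>..} (Sigma_sum p g) \<longrightarrow>
            (a - of_int \<lceil>a\<rceil>) * g (x + of_int \<lceil>a\<rceil>)
              \<le> (a - of_int \<lceil>a\<rceil>) * deriv (Sigma_sum p g) (x + of_int \<lceil>a\<rceil>) \<and>
            (a - of_int \<lceil>a\<rceil>) * deriv (Sigma_sum p g) (x + of_int \<lceil>a\<rceil>)
              \<le> Sigma_sum p g (x + a) - Sigma_sum p g (x + of_int \<lceil>a\<rceil>) \<and>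
            Sigma_sum p g (x + a) - Sigma_sum p g (x + of_int \<lceil>a\<rceil>)
              \<le> (a - of_int \<lceil>a\<rceil>) * g (x + of_int \<lfloor>a\<rfloor>))
       \<and> (concave_on {x + of_int \<lfloor>a\<rfloor>..} (Sigma_sum p g) \<longrightarrow>
            (a - of_int \<lceil>a\<rceil>) * g (x + of_int \<lceil>a\<rceil>)
              \<ge> (a - of_int \<lceil>a\<rceil>) * deriv (Sigma_sum p g) (x + of_int \<lceil>a\<rceil>) \<and>
            (a - of_int \<lceil>a\<rceil>) * deriv (Sigma_sum p g) (x + of_int \<lceil>a\<rceil>)
              \<ge> Sigma_sum p g (x + a) - Sigma_sum p g (x + of_int \<lceil>a\<rceil>) \<and>
            Sigma_sum p g (x + a) - Sigma_sum p g (x + of_int \<lceil>a\<rceil>)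
              \<ge> (a - of_int \<lceil>a\<rceil>) * g (x + of_int \<lfloor>a\<rfloor>))"
proof (cases "a = of_int \<lceil>a\<rceil>")
  case True
  then show ?thesis by simp
next
  case False
  let ?S = "Sigma_sum p g"
  define q where "q = max p 2"
  define c where "c = x + of_int \<lceil>a\<rceil>"
  define t where "t = of_int \<lceil>a\<rceil> - a"
  have floor: "of_int \<lfloor>a\<rfloor> = of_int \<lceil>a\<rceil> - (1::real)"
    using False by (auto simp: ceiling_altdef)
  have t: "0 \<le> t" "t \<le> 1" unfolding t_def by linarith+
  have points: "x + of_int \<lfloor>a\<rfloor> = c - 1" "x + a = c - t" "a - of_int \<lceil>a\<rceil> = - t"
    by (simp_all add: c_def t_def floor)
  have "0 \<le> \<lfloor>a\<rfloor>" using assms(2) by simp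
  then have c: "c - 1 > 0" using assms(3) points(1) by (metis add_pos_nonneg of_int_0_le_iff)
  have D: "g \<in> D_class p" and K: "g \<in> K_class q" and pq: "p \<le> q" and q2: "q \<ge> 2"
    using assms(1) by (auto simp: q_def)
  have shift: "?S (u + 1) = ?S u + g u" if "0 < u" for u
    using Sigma_sum_shift[OF D K pq] that by simp
  have "g differentiable_on {0<..}" using assms(1) by (auto simp: C_class_def dest: spec[of _ 0])
  then have g: "\<exists>D. (g has_real_derivative D) (at u)" if "0 < u" for u
    using that by (auto simp: differentiable_on_def real_differentiable_def at_within_open[of _ "{0<..}"])
  obtain A \<sigma> where \<sigma>: "\<sigma> = 1 \<or> \<sigma> = -1" "one_signed_dd q A \<sigma> ?S"
    using Sigma_sum_one_signed_dd[OF D K pq] by metis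
  \<comment> \<open>Far enough to the right for the sign condition on divided differences to be available.\<close>
  define N where "N = nat \<lceil>A + real q\<rceil>"
  have N: "A + real q \<le> c + real N" "c - 1 + 1 \<le> c + real N"
    using c unfolding N_def by linarith+
  have gval: "g c = ?S (c + 1) - ?S c" "g (c - 1) = ?S c - ?S (c - 1)"
    using shift[of c] shift[of "c - 1"] c by simp_all
  show ?thesis unfolding points c_def[symmetric] gval
  proof (intro conjI[of "_ \<longrightarrow> _"] impI)
    assume conv: "convex_on {c - 1..} ?S"
    have "\<exists>D. (?S has_real_derivative D) (at c)"
      by (rule differentiable_backwards_along_shift[OF shift g _
            convex_one_signed_dd_differentiable[OF \<sigma>(2,1) q2 N(1) conv N(2)]]) (use c in auto)
    then have "(?S has_real_derivative deriv ?S c) (at c)" using DERIV_imp_deriv by blast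
    from convex_chord_tangent_bounds[OF conv this t]
    show "- t * (?S (c + 1) - ?S c) \<le> - t * deriv ?S c \<and>
        - t * deriv ?S c \<le> ?S (c - t) - ?S c \<and>
        ?S (c - t) - ?S c \<le> - t * (?S c - ?S (c - 1))"
      by blast
  next
    assume "concave_on {c - 1..} ?S"
    then have conv: "convex_on {c - 1..} (\<lambda>u. - ?S u)" by (simp add: concave_on_def)
    have "one_signed_dd q A (- \<sigma>) (\<lambda>u. - ?S u)"
      using \<sigma>(2) dd_cmult[of "-1" ?S] by (simp add: one_signed_dd_def)
    moreover have "- \<sigma> = 1 \<or> - \<sigma> = -1" using \<sigma>(1) by auto
    ultimately have "\<exists>D. ((\<lambda>u. - ?S u) has_real_derivative D) (at (c + real N))"
      using convex_one_signed_dd_differentiable q2 N conv by blast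
    then have "\<exists>D. (?S has_real_derivative D) (at (c + real N))"
      using DERIV_minus[of "\<lambda>u. - ?S u"] by fastforce
    then have "\<exists>D. (?S has_real_derivative D) (at c)"
      by (rule differentiable_backwards_along_shift[OF shift g, rotated -1]) (use c in auto)
    then have "(?S has_real_derivative deriv ?S c) (at c)" using DERIV_imp_deriv by blast
    from convex_chord_tangent_bounds[OF conv DERIV_minus[OF this] t]
    show "- t * (?S (c + 1) - ?S c) \<ge> - t * deriv ?S c \<and>
        - t * deriv ?S c \<ge> ?S (c - t) - ?S c \<and>
        ?S (c - t) - ?S c \<ge> - t * (?S c - ?S (c - 1))"
      by (simp add: algebra_simps)
  qed
qed

end
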